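(* Let $G$ be a global amoeba of order $n$ with minimum degree $\delta(G)=1$. Then (i) $e(G)\le\lfloor n^2/4\rfloor$; (ii) $\omega(G)\le\chi(G)\le\lfloor n/2\rfloor+1$; and these bounds are sharp (there are global amoebas of order $n$ with minimum degree $1$ attaining them). Moreover: (iii) if $e(G)=\lfloor n^2/4\rfloor$ then $\omega(G)=\chi(G)=\lfloor n/2\rfloor+1$, but the converse is not true (there exist global amoebas $G$ of order $n$ with minimum degree $1$ and $\omega(G)=\chi(G)=\lfloor n/2\rfloor+1$ but $e(G)<\lfloor n^2/4\rfloor$); (iv) $\omega(G)=\lfloor n/2\rfloor+1$ if and only if $\chi(G)=\lfloor n/2\rfloor+1$.
   Context: $e(G)$, $\chi(G)$, $\omega(G)$ denote the number of edges, chromatic number and clique number of $G$. For a graph $G$ on vertex set $V=\{v_1,\dots,v_n\}$ let $L_G=\{ij: v_iv_j\in E(G)\}$; for $\sigma\in S_n$, $G_\sigma$ is the graph on $V$ with $E(G_\sigma)=\{v_{\sigma^{-1}(i)}v_{\sigma^{-1}(j)}: ij\in L_G\}$. An edge-replacement $e\to e'$ ($e\in E(G)$, $e'\in E(\overline G)\cup\{e\}$) is feasible if $G-e+e'\cong G$. Let $R_G$ be the set of feasible replacements $rs\to kl$ (meaning $v_rv_s\to v_kv_l$), $S_G(rs\to kl)=\{\sigma\in S_n: G_\sigma=G-v_rv_s+v_kv_l\}$, and $S_G\le S_n$ the group generated by $\bigcup_{rs\to kl\in R_G}S_G(rs\to kl)$. $G$ is a local amoeba if $S_G=S_n$; $G$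 is a global amoeba if there is $T\ge0$ such that $G\cup tK_1$ ($G$ plus $t$ isolated vertices) is a local amoeba for all $t\ge T$. *)

theory Defs
  imports "HOL-Library.Ramsey" "HOL-Algebra.Sym_Groups" "HOL-Algebra.Generated_Groups"
begin

section \<open>Finite simple graphs\<close>

text \<open>A graph is a pair of a vertex set and a set of two-element edges. As usual, the vertex
  set is nonempty.\<close>

type_synonym 'a ugraph = "'a set \<times> 'a set set"

abbreviation verts :: "'a ugraph \<Rightarrow> 'a set" where "verts G \<equiv> fst G"
abbreviation edges :: "'a ugraph \<Rightarrow> 'a set set" where "edges G \<equiv> snd G"

definition simple_graph :: "'a ugraph \<Rightarrow> bool" where
  "simple_graph G \<longleftrightarrow> finite (verts G) \<and> verts G \<noteq> {} \<and> edges G \<subseteq> [verts G]\<^bsup>2\<^esup>"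

abbreviation order_of :: "'a ugraph \<Rightarrow> nat" where "order_of G \<equiv> card (verts G)"

abbreviation num_edges :: "'a ugraph \<Rightarrow> nat" where "num_edges G \<equiv> card (edges G)"

definition degree :: "'a ugraph \<Rightarrow> 'a \<Rightarrow> nat" where
  "degree G x = card {e \<in> edges G. x \<in> e}"

definition min_degree :: "'a ugraph \<Rightarrow> nat" where
  "min_degree G = Min (degree G ` verts G)"

definition clique_number :: "'a ugraph \<Rightarrow> nat" where
  "clique_number G = Max {card K |K. K \<subseteq> verts G \<and> clique K (edges G)}"

definition colorable :: "'a ugraph \<Rightarrow> nat \<Rightarrow> bool" where
  "colorable G k \<longleftrightarrow>
     (\<exists>c :: 'a \<Rightarrow> nat. c ` verts G \<subseteq> {..<k} \<and> (\<forall>x y. {x, y} \<in> edges G \<longrightarrow> c x \<noteq> c y))"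

definition chromatic_number :: "'a ugraph \<Rightarrow> nat" where
  "chromatic_number G = (LEAST k. colorable G k)"

definition complement_edges :: "'a ugraph \<Rightarrow> 'a set set" where
  "complement_edges G = [verts G]\<^bsup>2\<^esup> - edges G"

definition isomorphic :: "'a ugraph \<Rightarrow> 'b ugraph \<Rightarrow> bool" where
  "isomorphic G H \<longleftrightarrow> (\<exists>f. bij_betw f (verts G) (verts H) \<and> edges H = (`) f ` edges G)"


section \<open>Edge replacements and amoebas\<close>

definition replace_edge :: "'a ugraph \<Rightarrow> 'a set \<Rightarrow> 'a set \<Rightarrow> 'a ugraph" where
  "replace_edge G e e' = (verts G, (edges G - {e}) \<union> {e'})"

definition feasible :: "'a ugraph \<Rightarrow> 'a set \<Rightarrow> 'a set \<Rightarrow> bool" where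
  "feasible G e e' \<longleftrightarrow>
     e \<in> edges G \<and> e' \<in> complement_edges G \<union> {e} \<and> isomorphic (replace_edge G e e') G"

text \<open>A labelling \<open>v\<close> enumerates the vertices as \<open>v 1, \<dots>, v n\<close>.\<close>

definition labelling :: "'a ugraph \<Rightarrow> (nat \<Rightarrow> 'a) \<Rightarrow> bool" where
  "labelling G v \<longleftrightarrow> bij_betw v {1..order_of G} (verts G)"

definition label_edges :: "'a ugraph \<Rightarrow> (nat \<Rightarrow> 'a) \<Rightarrow> nat set set" where
  "label_edges G v =
     {{i, j} |i j. i \<in> {1..order_of G} \<and> j \<in> {1..order_of G} \<and> {v i, v j} \<in> edges G}"

definition permuted_graph :: "'a ugraph \<Rightarrow> (nat \<Rightarrow> 'a) \<Rightarrow> (nat \<Rightarrow> nat) \<Rightarrow> 'a ugraph" where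
  "permuted_graph G v \<sigma> =
     (verts G, {{v (Hilbert_Choice.inv \<sigma> i), v (Hilbert_Choice.inv \<sigma> j)} |i j.
                  {i, j} \<in> label_edges G v})"

text \<open>The replacement \<open>rs \<rightarrow> kl\<close> is the pair of the label sets \<open>{r, s}\<close> and \<open>{k, l}\<close>.\<close>

definition feasible_replacements :: "'a ugraph \<Rightarrow> (nat \<Rightarrow> 'a) \<Rightarrow> (nat set \<times> nat set) set" where
  "feasible_replacements G v =
     {({r, s}, {k, l}) |r s k l. {r, s, k, l} \<subseteq> {1..order_of G} \<and>
        feasible G {v r, v s} {v k, v l}}"

definition replacement_perms ::
  "'a ugraph \<Rightarrow> (nat \<Rightarrow> 'a) \<Rightarrow> nat set \<Rightarrow> nat set \<Rightarrow> (nat \<Rightarrow> nat) set" where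
  "replacement_perms G v rs kl =
     {\<sigma> \<in> carrier (sym_group (order_of G)).
        permuted_graph G v \<sigma> = replace_edge G (v ` rs) (v ` kl)}"

definition amoeba_group :: "'a ugraph \<Rightarrow> (nat \<Rightarrow> 'a) \<Rightarrow> (nat \<Rightarrow> nat) set" where
  "amoeba_group G v =
     generate (sym_group (order_of G))
       (\<Union>(rs, kl) \<in> feasible_replacements G v. replacement_perms G v rs kl)"

text \<open>Relabelling the vertices conjugates \<^const>\<open>amoeba_group\<close> inside the symmetric group, so the
  choice of the labelling below is immaterial.\<close>

definition local_amoeba :: "'a ugraph \<Rightarrow> bool" where
  "local_amoeba G \<longleftrightarrow>
     (\<exists>v. labelling G v \<and> amoeba_group G v = carrier (sym_group (order_of G)))"

text \<open>The disjoint union of \<open>G\<close> and \<open>t\<close> isolated vertices lives on a sum type, to have fresh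
  vertices available.\<close>

definition add_isolated :: "'a ugraph \<Rightarrow> nat \<Rightarrow> ('a + nat) ugraph" where
  "add_isolated G t = (verts G <+> {..<t}, (`) Inl ` edges G)"

definition global_amoeba :: "'a ugraph \<Rightarrow> bool" where
  "global_amoeba G \<longleftrightarrow> (\<exists>T. \<forall>t\<ge>T. local_amoeba (add_isolated G t))"

end

theory Submission
  imports Defs
begin

text \<open>A permutation realising an edge replacement changes the degree of a label by at most one,
  and after adding isolated vertices a global amoeba has a vertex of degree zero. Hence every
  value from 1 to the maximum degree is a degree, and for each \<open>m \<le> n\<close> there are \<open>m\<close> vertices of
  degree at most \<open>m\<close> with degree sum at most \<open>1 + \<dots> + m\<close>. Put \<open>k = n div 2\<close> and
  \<open>m = n - k - 1\<close>. The remaining \<open>k + 1\<close> vertices span at most \<open>k (k + 1) / 2\<close> edges, which gives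
  the bound on the number of edges, with equality only if they form a clique. Greedy colouring of
  the low-degree vertices gives the bound on the chromatic number. If \<open>k\<close> colours do not
  suffice, discarding \<open>k - 1\<close> low-degree vertices leaves at most \<open>k + 2\<close> vertices that cannot be
  \<open>k\<close>-coloured, and these contain a clique of size \<open>k + 1\<close>.

  For sharpness take the graph on \<open>1, \<dots>, n\<close> with \<open>i\<close> and \<open>j\<close> adjacent iff \<open>i + j > n\<close>: swapping
  \<open>i\<close> and \<open>i + 1\<close> moves at most one edge. The bull graph shows that the clique number can be extremal
  without the number of edges being so.\<close>


section \<open>Exchanging two vertices by an edge replacement\<close>

lemma edge_doubletonE:
  assumes "simple_graph G" "e \<in> edges G"
  obtains x y where "e = {x, y}" "x \<in> verts G" "y \<in> verts G" "x \<noteq> y"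
proof -
  have "e \<in> [verts G]\<^bsup>2\<^esup>" using assms unfolding simple_graph_def by blast
  then show ?thesis using that by (rule nsets2_E)
qed

lemma finite_edges: "simple_graph G \<Longrightarrow> finite (edges G)"
  unfolding simple_graph_def by (meson finite_imp_finite_nsets finite_subset)

lemma simple_graph_edgeD:
  assumes "simple_graph G" "{x, y} \<in> edges G"
  shows "x \<in> verts G" "y \<in> verts G" "x \<noteq> y"
proof -
  have "{x, y} \<in> [verts G]\<^bsup>2\<^esup>" using assms unfolding simple_graph_def by blast
  then show "x \<in> verts G" "y \<in> verts G" "x \<noteq> y" by simp_all
qed

lemma labellingD:
  assumes "labelling G v"
  shows "inj_on v {1..order_of G}"
    and "i \<in> {1..order_of G} \<Longrightarrow> v i \<in> verts G"
    and "x \<in> verts G \<Longrightarrow> \<exists>i\<in>{1..order_of G}. v i = x"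
proof -
  have bij: "bij_betw v {1..order_of G} (verts G)" using assms by (simp add: labelling_def)
  show "inj_on v {1..order_of G}" using bij by (rule bij_betw_imp_inj_on)
  show "v i \<in> verts G" if "i \<in> {1..order_of G}" using bij that by (rule bij_betw_apply)
  show "\<exists>i\<in>{1..order_of G}. v i = x" if "x \<in> verts G"
    using bij that unfolding bij_betw_def by (metis imageE)
qed

text \<open>\<open>permuted_graph\<close> passes through labels; this turns it into the image under
  a vertex map. Only the values of \<open>\<pi>\<close> on labelled vertices are constrained, so
  both a transposition and a map built from \<open>inv_into\<close> can be used.\<close>

lemma permuted_graph_eq_image:
  assumes "simple_graph G" "labelling G v"
    and \<sigma>: "\<sigma> permutes {1..order_of G}"
    and \<pi>: "\<And>i. i \<in> {1..order_of G} \<Longrightarrow> \<pi> (v i) = v (inv' \<sigma> i)"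
  shows "permuted_graph G v \<sigma> = (verts G, (`) \<pi> ` edges G)"
proof -
  note v = labellingD[OF assms(2)]
  have "{{v (inv' \<sigma> i), v (inv' \<sigma> j)} |i j. {i, j} \<in> label_edges G v} = (`) \<pi> ` edges G"
    (is "?L = ?R")
  proof
    show "?L \<subseteq> ?R"
    proof
      fix e assume "e \<in> ?L"
      then obtain i j where e: "e = {v (inv' \<sigma> i), v (inv' \<sigma> j)}" and "{i, j} \<in> label_edges G v"
        by blast
      then have ij: "i \<in> {1..order_of G}" "j \<in> {1..order_of G}" "{v i, v j} \<in> edges G"
        unfolding label_edges_def by (auto simp: doubleton_eq_iff insert_commute)
      then have "e = \<pi> ` {v i, v j}" using e \<pi> by simp
      then show "e \<in> ?R" using ij by blast
    qed
    show "?R \<subseteq> ?L"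
    proof
      fix e assume "e \<in> ?R"
      then obtain a where a: "a \<in> edges G" "e = \<pi> ` a" by blast
      then obtain x y where xy: "a = {x, y}" "x \<in> verts G" "y \<in> verts G"
        using edge_doubletonE[OF assms(1)] by metis
      then obtain i j where ij: "i \<in> {1..order_of G}" "j \<in> {1..order_of G}" "x = v i" "y = v j"
        using v(3) by metis
      then have "{i, j} \<in> label_edges G v" unfolding label_edges_def using a xy by blast
      moreover have "e = {v (inv' \<sigma> i), v (inv' \<sigma> j)}" using a xy ij \<pi> by simp
      ultimately show "e \<in> ?L" by blast
    qed
  qed
  then show ?thesis unfolding permuted_graph_def by simp
qed

text \<open>Formulated on vertices, so that labels enter only once. Allowing \<open>e' = e\<close>
  includes transpositions that are automorphisms, provided that there is an edge.\<close>

definition exchangeable :: "'a ugraph \<Rightarrow> 'a \<Rightarrow> 'a \<Rightarrow> bool" where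
  "exchangeable G x y \<longleftrightarrow> x \<in> verts G \<and> y \<in> verts G \<and>
     (\<exists>e\<in>edges G. \<exists>e'\<in>complement_edges G \<union> {e}.
        (`) (Transposition.transpose x y) ` edges G = edges G - {e} \<union> {e'})"

text \<open>The vertex transposition is an involution, so it also maps the replaced graph back to
  \<open>G\<close>. Hence the replacement is feasible and the transposition of the labels is one of
  the generators.\<close>

lemma exchangeable_transpose_in_amoeba_group:
  assumes G: "simple_graph G" and lab: "labelling G v"
    and ij: "i \<in> {1..order_of G}" "j \<in> {1..order_of G}"
    and ex: "exchangeable G (v i) (v j)"
  shows "Transposition.transpose i j \<in> amoeba_group G v"
proof -
  let ?N = "{1..order_of G}" and ?\<tau> = "Transposition.transpose (v i) (v j)"
  note v = labellingD[OF lab]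
  note inj = v(1)
  obtain e e' where e: "e \<in> edges G" "e' \<in> complement_edges G \<union> {e}"
    and eq: "(`) ?\<tau> ` edges G = edges G - {e} \<union> {e'}"
    using ex unfolding exchangeable_def by (elim conjE bexE) (rule that)
  have lift: "\<exists>r s. a = {v r, v s} \<and> r \<in> ?N \<and> s \<in> ?N" if a: "a \<in> [verts G]\<^bsup>2\<^esup>" for a
  proof -
    obtain x y where "a = {x, y}" "x \<in> verts G" "y \<in> verts G" "x \<noteq> y"
      using a by (rule nsets2_E)
    then show ?thesis using v(3) by metis
  qed
  have sub: "e \<in> [verts G]\<^bsup>2\<^esup>" "e' \<in> [verts G]\<^bsup>2\<^esup>"
    using e G unfolding simple_graph_def complement_edges_def by auto
  obtain r s where rs: "e = {v r, v s}" "r \<in> ?N" "s \<in> ?N" using lift[OF sub(1)] by blast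
  obtain k l where kl: "e' = {v k, v l}" "k \<in> ?N" "l \<in> ?N" using lift[OF sub(2)] by blast
  have rep: "replace_edge G e e' = (verts G, (`) ?\<tau> ` edges G)"
    unfolding replace_edge_def eq ..
  have "bij_betw ?\<tau> (verts G) (verts G)"
    using v(2)[OF ij(1)] v(2)[OF ij(2)] by simp
  moreover have "edges G = (`) ?\<tau> ` (`) ?\<tau> ` edges G"
    by (simp add: image_image)
  ultimately have "isomorphic (replace_edge G e e') G"
    unfolding rep isomorphic_def fst_conv snd_conv by blast
  then have "feasible G {v r, v s} {v k, v l}"
    using e rs kl unfolding feasible_def by simp
  then have feas: "({r, s}, {k, l}) \<in> feasible_replacements G v"
    using rs kl unfolding feasible_replacements_def by blast
  have perm: "Transposition.transpose i j permutes ?N"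
    using ij by (simp add: permutes_swap_id)
  have "permuted_graph G v (Transposition.transpose i j) = (verts G, (`) ?\<tau> ` edges G)"
  proof (rule permuted_graph_eq_image[OF G lab perm])
    \<comment> \<open>A transposition is its own inverse; injectivity of \<open>v\<close> separates
      \<open>v m\<close> from \<open>v i\<close> and \<open>v j\<close>.\<close>
    fix m assume m: "m \<in> ?N"
    then show "?\<tau> (v m) = v (inv' (Transposition.transpose i j) m)"
      using inj_on_eq_iff[OF inj m ij(1)] inj_on_eq_iff[OF inj m ij(2)]
      by (auto simp: Transposition.transpose_def)
  qed
  then have "Transposition.transpose i j \<in> replacement_perms G v {r, s} {k, l}"
    using perm rep rs kl unfolding replacement_perms_def sym_group_carrier by simp
  then show ?thesis
    unfolding amoeba_group_def using feas by (blast intro: generate.incl)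
qed

text \<open>Transpositions along a connected graph generate the symmetric group: conjugation gives
  all transpositions through the label of \<open>c\<close>, then all transpositions, and these
  compose to all permutations.\<close>

lemma local_amoeba_if_exchangeable_connected:
  assumes G: "simple_graph G" and c: "c \<in> verts G"
    and conn: "\<And>x. x \<in> verts G \<Longrightarrow> (exchangeable G)\<^sup>*\<^sup>* c x"
  shows "local_amoeba G"
proof -
  let ?N = "{1..order_of G}" and ?S = "sym_group (order_of G)"
  have "finite (verts G)" using G by (simp add: simple_graph_def)
  then obtain v where lab: "labelling G v"
    unfolding labelling_def using ex_bij_betw_nat_finite_1 by blast
  note v = labellingD[OF lab]
  let ?A = "amoeba_group G v"
  have comp: "p \<circ> q \<in> ?A" if "p \<in> ?A" "q \<in> ?A" for p q
    using generate.eng[of p ?S _ q] that unfolding amoeba_group_def sym_group_mult by simp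
  have id: "id \<in> ?A"
    using generate.one[of ?S] unfolding amoeba_group_def sym_group_one by simp
  \<comment> \<open>Conjugation handles three distinct labels; otherwise the transposition is the
    identity or one of the two given ones.\<close>
  have conj: "Transposition.transpose i k \<in> ?A"
    if "Transposition.transpose i j \<in> ?A" "Transposition.transpose j k \<in> ?A" for i j k
  proof (cases "i = k \<or> i = j \<or> j = k")
    case True
    then show ?thesis using that id by auto
  next
    case False
    have "Transposition.transpose i k =
        Transposition.transpose i j \<circ> Transposition.transpose j k \<circ> Transposition.transpose i j"
      using False by (auto simp: Transposition.transpose_def fun_eq_iff)
    then show ?thesis using comp[OF comp[OF that] that(1)] by simp
  qed
  obtain i0 where i0: "i0 \<in> ?N" "v i0 = c" using v(3)[OF c] by blast
  have root: "\<exists>i\<in>?N. v i = x \<and> Transposition.transpose i0 i \<in> ?A"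
    if "(exchangeable G)\<^sup>*\<^sup>* c x" for x
    using that
  proof (induction rule: rtranclp_induct)
    case base
    then show ?case using i0 id by (intro bexI[of _ i0]) (auto simp: id_def)
  next
    case (step y z)
    then obtain i where i: "i \<in> ?N" "v i = y" "Transposition.transpose i0 i \<in> ?A" by blast
    have "z \<in> verts G" using step by (simp add: exchangeable_def)
    then obtain j where j: "j \<in> ?N" "v j = z" using v(3) by blast
    have "Transposition.transpose i j \<in> ?A"
      using exchangeable_transpose_in_amoeba_group[OF G lab i(1) j(1)] step i j by simp
    then show ?case using conj i j by blast
  qed
  have root': "Transposition.transpose i0 i \<in> ?A" if i: "i \<in> ?N" for i
  proof -
    obtain i' where i': "i' \<in> ?N" "v i' = v i" "Transposition.transpose i0 i' \<in> ?A"
      using root[OF conn[OF v(2)[OF i]]] by blast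
    then have "i' = i" using inj_onD[OF v(1) i'(2)] i i'(1) by blast
    then show ?thesis using i' by simp
  qed
  have trans: "Transposition.transpose i j \<in> ?A" if "i \<in> ?N" "j \<in> ?N" for i j
    using conj[OF _ root'[OF that(2)]] root'[OF that(1)] by (simp add: transpose_commute)
  have all: "p \<in> ?A" if "p permutes ?N" for p
    using that finite_atLeastAtMost
    by (induction rule: permutes_induct) (simp_all only: id comp trans)
  have "group ?S" by (rule sym_group_is_group)
  then have "?A \<subseteq> carrier ?S"
    unfolding amoeba_group_def
    by (rule group.generate_incl) (auto simp: replacement_perms_def)
  then have "?A = carrier ?S" using all by (auto simp: sym_group_carrier)
  then show ?thesis unfolding local_amoeba_def using lab by blast
qed


section \<open>Degrees in a global amoeba\<close>

lemma degree_image: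
  assumes "simple_graph G" "inj_on \<pi> (verts G)" "x \<in> verts G"
  shows "degree (verts G, (`) \<pi> ` edges G) (\<pi> x) = degree G x"
proof -
  have sub: "e \<subseteq> verts G" if "e \<in> edges G" for e
    using edge_doubletonE[OF assms(1) that] by blast
  have "{e \<in> (`) \<pi> ` edges G. \<pi> x \<in> e} = (`) \<pi> ` {e \<in> edges G. x \<in> e}"
    using sub assms by (auto dest: inj_onD)
  moreover have "inj_on ((`) \<pi>) {e \<in> edges G. x \<in> e}"
    using sub assms(2) by (intro inj_onI) (metis (no_types, lifting) inj_on_image_eq_iff mem_Collect_eq)
  ultimately show ?thesis unfolding degree_def by (simp add: card_image)
qed

text \<open>The set of edges at \<open>x\<close> loses at most \<open>e\<close> and gains at most
  \<open>e'\<close>.\<close>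

lemma degree_replace_edge_bounds:
  assumes "simple_graph G"
  shows "degree (replace_edge G e e') x \<le> degree G x + 1"
    and "degree G x \<le> degree (replace_edge G e e') x + 1"
proof -
  let ?A = "{a \<in> edges G. x \<in> a}" and ?B = "{a \<in> edges G - {e} \<union> {e'}. x \<in> a}"
  have fin: "finite ?A" using finite_edges[OF assms] by simp
  moreover have sub: "?B \<subseteq> insert e' ?A" "?A \<subseteq> insert e ?B" by auto
  ultimately have finB: "finite ?B" by (meson finite_insert finite_subset)
  have "card ?B \<le> card (insert e' ?A)" using sub fin by (intro card_mono) auto
  also have "\<dots> \<le> card ?A + 1" by (simp add: fin card_insert_if)
  finally show "degree (replace_edge G e e') x \<le> degree G x + 1"
    unfolding degree_def replace_edge_def by simp
  have "card ?A \<le> card (insert e ?B)" using sub finB by (intro card_mono) auto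
  also have "\<dots> \<le> card ?B + 1" using card_insert_le_m1[of "card ?B + 1"] finB by (simp add: card_insert_if)
  finally show "degree G x \<le> degree (replace_edge G e e') x + 1"
    unfolding degree_def replace_edge_def by simp
qed

text \<open>Every generator changes the degree of a label by at most one, so the labels of degree
  above a missing value would form a proper invariant set.\<close>

lemma local_amoeba_degree_between:
  assumes G: "simple_graph G" and "local_amoeba G"
    and xy: "x \<in> verts G" "y \<in> verts G" and r: "degree G x \<le> r" "r \<le> degree G y"
  shows "\<exists>z\<in>verts G. degree G z = r"
proof (rule ccontr)
  assume none: "\<not> ?thesis"
  let ?N = "{1..order_of G}" and ?S = "sym_group (order_of G)"
  obtain v where lab: "labelling G v" and full: "amoeba_group G v = carrier ?S"
    using assms(2) unfolding local_amoeba_def by blast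
  note v = labellingD[OF lab]
  note inj = v(1)
  let ?P = "\<lambda>p. p permutes ?N \<and> (\<forall>i\<in>?N. r < degree G (v (p i)) \<longleftrightarrow> r < degree G (v i))"
  have gen: "?P p" if p: "p \<in> replacement_perms G v rs kl" for p rs kl
  proof -
    have perm: "p permutes ?N" and eq: "permuted_graph G v p = replace_edge G (v ` rs) (v ` kl)"
      using p unfolding replacement_perms_def sym_group_carrier by auto
    \<comment> \<open>The vertex map induced by the inverse of \<open>p\<close>; its values outside
      \<open>verts G\<close> are irrelevant.\<close>
    define \<pi> where "\<pi> x = v (inv' p (inv_into ?N v x))" for x
    have \<pi>: "\<pi> (v i) = v (inv' p i)" if "i \<in> ?N" for i
      unfolding \<pi>_def using inj that by simp
    have invp: "inv' p permutes ?N" using perm by (rule permutes_inv)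
    have inj\<pi>: "inj_on \<pi> (verts G)"
      proof (rule inj_onI)
      fix x y assume xy: "x \<in> verts G" "y \<in> verts G" "\<pi> x = \<pi> y"
      then obtain i j where ij: "i \<in> ?N" "v i = x" "j \<in> ?N" "v j = y" using v(3) by metis
      then have "v (inv' p i) = v (inv' p j)" using xy \<pi> by metis
      moreover have "inv' p i \<in> ?N" "inv' p j \<in> ?N"
        using ij permutes_in_image[OF invp] by auto
      ultimately have "inv' p i = inv' p j" using inj by (metis inj_onD)
      then show "x = y" using permutes_inj[OF invp] ij by (metis injD)
    qed
    have img: "replace_edge G (v ` rs) (v ` kl) = (verts G, (`) \<pi> ` edges G)"
      using permuted_graph_eq_image[OF G lab perm \<pi>] eq by simp
    have "r < degree G (v (p i)) \<longleftrightarrow> r < degree G (v i)" if i: "i \<in> ?N" for i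
    proof -
      have pi: "p i \<in> ?N" using perm i permutes_in_image by metis
      then have vs: "v (p i) \<in> verts G" "v i \<in> verts G" using v(2) i by auto
      have "\<pi> (v (p i)) = v i" using \<pi>[OF pi] perm by (simp add: permutes_inverses)
      then have "degree (replace_edge G (v ` rs) (v ` kl)) (v i) = degree G (v (p i))"
        unfolding img using degree_image[OF G inj\<pi> vs(1)] by simp
      then have "degree G (v (p i)) \<le> degree G (v i) + 1" "degree G (v i) \<le> degree G (v (p i)) + 1"
        using degree_replace_edge_bounds[OF G] by metis+
      \<comment> \<open>Two degrees that differ by at most one and both avoid \<open>r\<close> lie
        on the same side of \<open>r\<close>.\<close>
      moreover have "degree G (v (p i)) \<noteq> r" "degree G (v i) \<noteq> r" using none vs by auto
      ultimately show ?thesis by linarith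
    qed
    then show ?thesis using perm by blast
  qed
  have "?P p" if "p \<in> amoeba_group G v" for p
    using that unfolding amoeba_group_def
  proof (induction rule: generate.induct)
    case one
    then show ?case unfolding sym_group_one by (intro conjI permutes_id) simp
  next
    case (incl h)
    then show ?case using gen by blast
  next
    case (inv h)
    then have h: "?P h" using gen by blast
    then have inv: "inv\<^bsub>?S\<^esub> h = inv' h" by (simp add: sym_group_carrier)
    have "h (inv' h i) = i" "inv' h i \<in> ?N" if "i \<in> ?N" for i
      using h that permutes_in_image[OF permutes_inv, of h ?N i] by (auto simp: permutes_inverses)
    then have "\<forall>i\<in>?N. r < degree G (v (inv' h i)) \<longleftrightarrow> r < degree G (v i)"
      using h by metis
    then show ?case unfolding inv using h permutes_inv by blast
  next
    case (eng h1 h2)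
    then have h: "?P h1" "?P h2" by blast+
    then have "h2 i \<in> ?N" if "i \<in> ?N" for i using that permutes_in_image[of h2 ?N i] by blast
    then have "\<forall>i\<in>?N. r < degree G (v ((h1 \<circ> h2) i)) \<longleftrightarrow> r < degree G (v i)"
      using h unfolding comp_def by metis
    then show ?case unfolding sym_group_mult using h permutes_compose by blast
  qed
  \<comment> \<open>The full group contains the transposition of the labels of \<open>x\<close> and
    \<open>y\<close>, whose degrees lie strictly on opposite sides of the missing value.\<close>
  moreover obtain i j where ij: "i \<in> ?N" "j \<in> ?N" "v i = x" "v j = y" using v(3) xy by metis
  then have "Transposition.transpose i j \<in> amoeba_group G v"
    unfolding full sym_group_carrier by (simp add: permutes_swap_id)
  ultimately have "r < degree G y \<longleftrightarrow> r < degree G x"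
    using ij by fastforce
  then show False using r none xy by (metis le_neq_implies_less linorder_not_less)
qed

section \<open>Degrees after adding isolated vertices\<close>

lemma simple_graph_add_isolated:
  assumes "simple_graph G"
  shows "simple_graph (add_isolated G t)"
proof -
  have "e \<in> [verts G <+> {..<t}]\<^bsup>2\<^esup>" if "e \<in> (`) Inl ` edges G" for e
    using that by (auto elim!: edge_doubletonE[OF assms])
  then show ?thesis using assms unfolding simple_graph_def add_isolated_def by auto
qed

lemma Inl_doubleton_in_edges_iff [simp]:
  fixes G :: "'a ugraph"
  shows "{Inl x, Inl y} \<in> edges (add_isolated G t) \<longleftrightarrow> {x, y} \<in> edges G"
proof -
  have "{Inl x, Inl y :: 'a + nat} = Inl ` e \<longleftrightarrow> {x, y} = e" for e :: "'a set"
    using inj_image_eq_iff[OF inj_Inl, of "{x, y}" e] by simp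
  then show ?thesis
    unfolding add_isolated_def by (simp add: image_iff)
qed

lemma degree_add_isolated:
  fixes G :: "'a ugraph"
  shows "degree (add_isolated G t) (Inl x) = degree G x"
    and "degree (add_isolated G t) (Inr i) = 0"
proof -
  have "{e \<in> (`) Inl ` edges G. (Inl x :: 'a + nat) \<in> e} = (`) Inl ` {e \<in> edges G. x \<in> e}" by auto
  moreover have "card ((`) (Inl :: 'a \<Rightarrow> 'a + nat) ` {e \<in> edges G. x \<in> e}) = card {e \<in> edges G. x \<in> e}"
    by (rule card_image) (simp add: inj_on_def inj_image_eq_iff)
  ultimately show "degree (add_isolated G t) (Inl x) = degree G x"
    unfolding degree_def add_isolated_def snd_conv by (simp only:)
  have "{e \<in> (`) Inl ` edges G. (Inr i :: 'a + nat) \<in> e} = {}" by auto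
  then show "degree (add_isolated G t) (Inr i) = 0"
    unfolding degree_def add_isolated_def by (metis card.empty snd_conv)
qed

lemma global_amoeba_degree_realised:
  assumes "simple_graph G" "global_amoeba G" "y \<in> verts G" "0 < r" "r \<le> degree G y"
  shows "\<exists>z\<in>verts G. degree G z = r"
proof -
  obtain T where T: "\<forall>t\<ge>T. local_amoeba (add_isolated G t)"
    using assms(2) unfolding global_amoeba_def by blast
  \<comment> \<open>\<open>Suc T\<close> guarantees an added vertex, of degree zero, even for
    \<open>T = 0\<close>. A vertex realising the positive value \<open>r\<close> then cannot be an
    added one.\<close>
  let ?H = "add_isolated G (Suc T)"
  have "Inr 0 \<in> verts ?H" "Inl y \<in> verts ?H"
    using assms by (auto simp: add_isolated_def)
  then obtain z where z: "z \<in> verts ?H" "degree ?H z = r"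
    using local_amoeba_degree_between[of ?H "Inr 0" "Inl y" r] T assms
    by (auto simp: simple_graph_add_isolated degree_add_isolated)
  then obtain x where "z = Inl x"
    using assms(4) by (cases z) (auto simp: degree_add_isolated)
  moreover have "x \<in> verts G" using z(1) calculation by (auto simp: add_isolated_def)
  ultimately show ?thesis using z(2) by (auto simp: degree_add_isolated)
qed

lemma min_degree_le_degree:
  assumes "simple_graph G" "min_degree G = d" "x \<in> verts G"
  shows "d \<le> degree G x"
  using assms unfolding simple_graph_def min_degree_def by (auto intro: Min_le)

text \<open>Induction on \<open>m\<close>, adding one vertex of degree at most \<open>Suc m\<close>.
  If the chosen outside vertex \<open>y\<close> has larger degree, the absence of gaps supplies a
  vertex of degree exactly \<open>Suc m\<close>, which is new because degrees in \<open>L\<close>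
  are at most \<open>m\<close>.\<close>

lemma ex_low_degree_subset:
  assumes G: "simple_graph G"
    and pos: "\<And>x. x \<in> verts G \<Longrightarrow> 0 < degree G x"
    and gap: "\<And>y r. y \<in> verts G \<Longrightarrow> 0 < r \<Longrightarrow> r \<le> degree G y \<Longrightarrow> \<exists>z\<in>verts G. degree G z = r"
    and "m \<le> order_of G"
  shows "\<exists>L\<subseteq>verts G. card L = m \<and> (\<forall>x\<in>L. degree G x \<le> m) \<and> sum (degree G) L \<le> Suc m choose 2"
  using \<open>m \<le> order_of G\<close>
proof (induction m)
  case 0
  then show ?case by (intro exI[of _ "{}"]) auto
next
  case (Suc m)
  then obtain L where L: "L \<subseteq> verts G" "card L = m" "\<forall>x\<in>L. degree G x \<le> m"
    "sum (degree G) L \<le> Suc m choose 2"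
    by auto
  have fin: "finite (verts G)" using G by (simp add: simple_graph_def)
  then have finL: "finite L" using L finite_subset by blast
  obtain y where y: "y \<in> verts G - L"
  proof -
    have "card L < card (verts G)" using Suc.prems L by simp
    then show ?thesis using that L fin by (metis card_mono finL leD subset_iff Diff_iff)
  qed
  have "\<exists>x\<in>verts G - L. degree G x \<le> Suc m"
  proof (cases "degree G y \<le> Suc m")
    case True
    then show ?thesis using y by blast
  next
    case False
    then obtain z where z: "z \<in> verts G" "degree G z = Suc m"
      using gap[of y "Suc m"] y by auto
    then have "z \<notin> L" using L by auto
    then show ?thesis using z by (intro bexI[of _ z]) auto
  qed
  then obtain x where x: "x \<in> verts G" "x \<notin> L" "degree G x \<le> Suc m" by blast
  have "Suc (Suc m) choose 2 = Suc m + (Suc m choose 2)" by (simp add: numeral_2_eq_2)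
  then show ?case
    using x L finL by (intro exI[of _ "insert x L"]) auto
qed

text \<open>An edge either meets \<open>L\<close>, and is counted by the degree sum, or is a pair
  inside the complement of \<open>L\<close>. Equality forces every such pair to be an edge.\<close>

lemma num_edges_le_degree_sum:
  assumes G: "simple_graph G" and L: "L \<subseteq> verts G"
  shows "num_edges G \<le> sum (degree G) L + (card (verts G - L) choose 2)"
    and "num_edges G = sum (degree G) L + (card (verts G - L) choose 2)
      \<Longrightarrow> clique (verts G - L) (edges G)"
proof -
  have fin: "finite (verts G)" using G by (simp add: simple_graph_def)
  let ?R = "verts G - L"
  let ?A = "\<Union>x\<in>L. {e \<in> edges G. x \<in> e}"
  have finR: "finite ([?R]\<^bsup>2\<^esup>)" using fin by (simp add: finite_imp_finite_nsets)
  have cover: "edges G \<subseteq> ?A \<union> (edges G \<inter> [?R]\<^bsup>2\<^esup>)"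
  proof
    fix e assume e: "e \<in> edges G"
    then obtain x y where "e = {x, y}" "x \<in> verts G" "y \<in> verts G" "x \<noteq> y"
      using edge_doubletonE[OF G] by metis
    then show "e \<in> ?A \<union> (edges G \<inter> [?R]\<^bsup>2\<^esup>)" using e by auto
  qed
  have A: "card ?A \<le> sum (degree G) L"
    unfolding degree_def using L fin by (intro card_UN_le) (auto intro: finite_subset)
  have bound: "num_edges G \<le> card ?A + card (edges G \<inter> [?R]\<^bsup>2\<^esup>)"
  proof -
    have "num_edges G \<le> card (?A \<union> (edges G \<inter> [?R]\<^bsup>2\<^esup>))"
      using cover finite_edges[OF G] by (intro card_mono) (auto intro: finite_subset)
    then show ?thesis using card_Un_le order_trans by blast
  qed
  have R: "card (edges G \<inter> [?R]\<^bsup>2\<^esup>) \<le> card ?R choose 2"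
    using card_mono[OF finR] by (metis card_nsets inf_le2)
  show "num_edges G \<le> sum (degree G) L + (card ?R choose 2)" using A bound R by linarith
  assume "num_edges G = sum (degree G) L + (card ?R choose 2)"
  then have "card (edges G \<inter> [?R]\<^bsup>2\<^esup>) = card ([?R]\<^bsup>2\<^esup>)" using A bound R by simp
  then have "edges G \<inter> [?R]\<^bsup>2\<^esup> = [?R]\<^bsup>2\<^esup>" using finR by (simp add: card_subset_eq)
  then have "[?R]\<^bsup>2\<^esup> \<subseteq> edges G" by blast
  then show "clique ?R (edges G)"
    unfolding clique_def by (auto simp: subset_iff)
qed


section \<open>Colourings and cliques\<close>

text \<open>The colouring of \<open>W\<close> is extended one vertex at a time: an outside vertex
  has fewer than \<open>q\<close> neighbours in the whole graph, so a colour is free.\<close>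

lemma colorable_greedy:
  assumes G: "simple_graph G" and W: "W \<subseteq> verts G"
    and c: "c ` W \<subseteq> {..<q}" "\<And>x y. x \<in> W \<Longrightarrow> y \<in> W \<Longrightarrow> {x, y} \<in> edges G \<Longrightarrow> c x \<noteq> c y"
    and deg: "\<And>x. x \<in> verts G - W \<Longrightarrow> degree G x < q"
  shows "colorable G q"
proof -
  have finV: "finite (verts G)" using G by (simp add: simple_graph_def)
  have "\<exists>c. c ` (W \<union> F) \<subseteq> {..<q} \<and> (\<forall>x\<in>W \<union> F. \<forall>y\<in>W \<union> F. {x, y} \<in> edges G \<longrightarrow> c x \<noteq> c y)"
    if "finite F" "F \<subseteq> verts G - W" for F
    using that
  proof (induction F)
    case empty
    show ?case using c by (intro exI[of _ c]) simp
  next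
    case (insert x F)
    then obtain d where d: "d ` (W \<union> F) \<subseteq> {..<q}"
      "\<forall>x\<in>W \<union> F. \<forall>y\<in>W \<union> F. {x, y} \<in> edges G \<longrightarrow> d x \<noteq> d y"
      by auto
    let ?N = "{y. {x, y} \<in> edges G}"
    have "(\<lambda>y. {x, y}) ` ?N \<subseteq> {e \<in> edges G. x \<in> e}" by blast
    moreover have "inj_on (\<lambda>y. {x, y}) ?N" by (rule inj_onI) (metis doubleton_eq_iff)
    moreover have "finite {e \<in> edges G. x \<in> e}" using finite_edges[OF G] by simp
    ultimately have N: "finite ?N" "card ?N \<le> degree G x"
      unfolding degree_def by (meson inj_on_finite, meson card_inj_on_le)
    \<comment> \<open>\<open>d\<close> is evaluated at all neighbours, even uncoloured ones; this
      can only enlarge the set of colours to avoid and stays within the degree bound.\<close>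
    then have "card (d ` ?N) < q"
      using deg[of x] insert.prems card_image_le[OF N(1), of d] by force
    then have "\<not> {..<q} \<subseteq> d ` ?N"
      using N(1) by (metis card_lessThan card_mono finite_imageI linorder_not_less)
    then obtain a where a: "a < q" "a \<notin> d ` ?N" by blast
    have "{x, x} \<notin> edges G" using simple_graph_edgeD(3)[OF G] by blast
    then have "(d(x := a)) y \<noteq> (d(x := a)) z"
      if "y \<in> W \<union> insert x F" "z \<in> W \<union> insert x F" "{y, z} \<in> edges G" for y z
      using that d(2) a(2) by (auto simp: insert_commute)
    moreover have "(d(x := a)) ` (W \<union> insert x F) \<subseteq> {..<q}" using d(1) a(1) by auto
    ultimately show ?case by blast
  qed
  from this[of "verts G - W"] obtain d where d: "d ` verts G \<subseteq> {..<q}"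
    "\<forall>x\<in>verts G. \<forall>y\<in>verts G. {x, y} \<in> edges G \<longrightarrow> d x \<noteq> d y"
    using finV W by (auto simp: Un_absorb1)
  have "d x \<noteq> d y" if "{x, y} \<in> edges G" for x y
    using d(2) simple_graph_edgeD(1,2)[OF G that] that by blast
  then show ?thesis unfolding colorable_def using d(1) by blast
qed

text \<open>Here the colours of \<open>W\<close> are arbitrary values of \<open>f\<close>, typically
  representatives of the colour classes; \<open>h\<close> numbers them from 0.\<close>

lemma colorable_if_merged:
  assumes G: "simple_graph G" and W: "W \<subseteq> verts G"
    and f: "card (f ` W) \<le> q"
      "\<And>x y. x \<in> W \<Longrightarrow> y \<in> W \<Longrightarrow> x \<noteq> y \<Longrightarrow> f x = f y \<Longrightarrow> {x, y} \<notin> edges G"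
    and deg: "\<And>x. x \<in> verts G - W \<Longrightarrow> degree G x < q"
  shows "colorable G q"
proof -
  have "finite (f ` W)" using G W by (auto simp: simple_graph_def intro: finite_subset)
  from finite_imp_inj_to_nat_seg[OF this] obtain h and n :: nat
    where h: "h ` f ` W = {i. i < n}" "inj_on h (f ` W)"
    by (elim exE conjE) (rule that)
  have "n = card (h ` f ` W)" unfolding h(1) by simp
  also have "\<dots> = card (f ` W)" using h(2) by (rule card_image)
  finally have "(h \<circ> f) ` W \<subseteq> {..<q}" using h(1) f(1) by (auto simp: image_comp)
  moreover have "(h \<circ> f) x \<noteq> (h \<circ> f) y" if "x \<in> W" "y \<in> W" "{x, y} \<in> edges G" for x y
    using that f(2)[of x y] simple_graph_edgeD(3)[OF G that(3)] h(2)
    by (auto dest: inj_onD)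
  ultimately show ?thesis using colorable_greedy[OF G W _ _ deg] by blast
qed

lemma chromatic_number_le: "colorable G k \<Longrightarrow> chromatic_number G \<le> k"
  unfolding chromatic_number_def by (rule Least_le)

lemma clique_card_le_if_colorable:
  assumes "colorable G k" "K \<subseteq> verts G" "clique K (edges G)"
  shows "card K \<le> k"
proof -
  obtain c where c: "c ` verts G \<subseteq> {..<k}" "\<forall>x y. {x, y} \<in> edges G \<longrightarrow> c x \<noteq> (c y :: nat)"
    using assms(1) unfolding colorable_def by blast
  have "inj_on c K" using c(2) assms(3) unfolding clique_def by (meson inj_onI)
  moreover have "c ` K \<subseteq> {..<k}" using c(1) assms(2) by blast
  ultimately show ?thesis by (metis card_inj_on_le card_lessThan finite_lessThan)
qed

lemma colorable_chromatic_number: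
  assumes "simple_graph G"
  shows "colorable G (chromatic_number G)"
proof -
  have "colorable G (order_of G)"
    using colorable_if_merged[OF assms, of "verts G" id] by simp
  then show ?thesis unfolding chromatic_number_def by (rule LeastI)
qed

lemma
  assumes "simple_graph G"
  shows card_le_clique_number: "K \<subseteq> verts G \<Longrightarrow> clique K (edges G) \<Longrightarrow> card K \<le> clique_number G"
    and ex_maximum_clique: "\<exists>K\<subseteq>verts G. clique K (edges G) \<and> card K = clique_number G"
proof -
  let ?C = "{card K |K. K \<subseteq> verts G \<and> clique K (edges G)}"
  have "finite (card ` Pow (verts G))" using assms by (simp add: simple_graph_def)
  moreover have "?C \<subseteq> card ` Pow (verts G)" by auto
  ultimately have fin: "finite ?C" by (rule finite_subset[rotated])
  then show "K \<subseteq> verts G \<Longrightarrow> clique K (edges G) \<Longrightarrow> card K \<le> clique_number G"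
    unfolding clique_number_def using Max_ge[OF fin, of "card K"] by blast
  \<comment> \<open>The empty clique makes the set nonempty, so its \<open>Max\<close> is
    attained.\<close>
  have "clique {} (edges G)" by (simp add: clique_def)
  then have "?C \<noteq> {}" by blast
  then have "Max ?C \<in> ?C" using fin by (rule Max_in[rotated])
  then obtain K where "Max ?C = card K" "K \<subseteq> verts G" "clique K (edges G)"
    by (elim CollectE exE conjE) (rule that)
  then show "\<exists>K\<subseteq>verts G. clique K (edges G) \<and> card K = clique_number G"
    unfolding clique_number_def by (intro exI[of _ K]) simp
qed

lemma clique_number_le_chromatic_number:
  "simple_graph G \<Longrightarrow> clique_number G \<le> chromatic_number G"
  using clique_card_le_if_colorable[OF colorable_chromatic_number] ex_maximum_clique by metis

text \<open>If the non-edges inside \<open>W\<close> contain two disjoint pairs or a triangle, merging them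
  yields a colouring; otherwise they all share a vertex, whose removal leaves a clique.\<close>

lemma clique_if_not_colorable:
  assumes G: "simple_graph G" and W: "W \<subseteq> verts G" "card W = k + 1 \<or> card W = k + 2"
    and deg: "\<And>x. x \<in> verts G - W \<Longrightarrow> degree G x < k"
    and nc: "\<not> colorable G k"
  shows "\<exists>K\<subseteq>W. clique K (edges G) \<and> card K = k + 1"
proof (rule ccontr)
  assume none: "\<not> ?thesis"
  have fin: "finite W" using W by (metis card_ge_0_finite add_gr_0 zero_less_numeral zero_less_one)
  let ?n = "\<lambda>x y. x \<in> W \<and> y \<in> W \<and> x \<noteq> y \<and> {x, y} \<notin> edges G"
  \<comment> \<open>\<open>D\<close> collects the vertices merged into others. The representatives
    lie in \<open>W - D\<close>, hence \<open>k\<close> colours would suffice.\<close>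
  have merged: False
    if "f ` W \<subseteq> W - D" "D \<subseteq> W" "card W \<le> k + card D"
      "\<And>x y. x \<in> W \<Longrightarrow> y \<in> W \<Longrightarrow> x \<noteq> y \<Longrightarrow> f x = f y \<Longrightarrow> {x, y} \<notin> edges G" for f D
  proof -
    have "card (f ` W) \<le> card (W - D)" using that(1) fin by (intro card_mono) auto
    also have "\<dots> = card W - card D" using that(2) fin by (meson card_Diff_subset finite_subset)
    finally have "card (f ` W) \<le> k" using that(3) by linarith
    then show False using colorable_if_merged[OF G W(1) _ that(4) deg] nc by blast
  qed
  show False
  proof (cases "card W = k + 1")
    case True
    then obtain a b where ab: "?n a b" using none unfolding clique_def by blast
    show False
      using ab True by (intro merged[of "id(b := a)" "{b}"]) (auto simp: insert_commute split: if_splits)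
  next
    case False
    then have card: "card W = k + 2" using W by blast
    \<comment> \<open>Deleting \<open>w\<close> leaves \<open>k + 1\<close> vertices that are not a
      clique, so no single vertex meets all non-edges.\<close>
    have star: "\<exists>p q. ?n p q \<and> p \<noteq> w \<and> q \<noteq> w" if "w \<in> W" for w
    proof -
      have "card (W - {w}) = k + 1" using card that fin by simp
      then have "\<not> clique (W - {w}) (edges G)" using none by blast
      then show ?thesis unfolding clique_def by blast
    qed
    have sym: "?n x y \<Longrightarrow> ?n y x" for x y by (auto simp: insert_commute)
    \<comment> \<open>Merging the ends of each of two disjoint non-edges saves two colours.\<close>
    have disj: "\<not> (?n p q \<and> p \<noteq> a \<and> p \<noteq> b \<and> q \<noteq> a \<and> q \<noteq> b)" if "?n a b" for a b p q
    proof
      assume pq: "?n p q \<and> p \<noteq> a \<and> p \<noteq> b \<and> q \<noteq> a \<and> q \<noteq> b"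
      show False
        using that pq card
        by (intro merged[of "id(b := a, q := p)" "{b, q}"]) (auto simp: insert_commute split: if_splits)
    qed
    \<comment> \<open>Three pairwise non-adjacent vertices become one colour class, which also saves
      two colours.\<close>
    have triangle: "\<not> (?n b c \<and> ?n a c)" if "?n a b" for a b c
    proof
      assume c: "?n b c \<and> ?n a c"
      show False
        using that c card
        by (intro merged[of "id(b := a, c := a)" "{b, c}"]) (auto simp: insert_commute split: if_splits)
    qed
    have "W \<noteq> {}" using card by auto
    then obtain a b where ab: "?n a b" using star by blast
    \<comment> \<open>A non-edge avoiding \<open>a\<close> must meet \<open>{a, b}\<close>, so it is
      \<open>{b, c}\<close> for some \<open>c\<close>. A non-edge avoiding \<open>b\<close> must
      meet both \<open>{a, b}\<close> and \<open>{b, c}\<close>, so it is \<open>{a, c}\<close>: a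
      triangle.\<close>
    obtain p q where pq: "?n p q" "p \<noteq> a" "q \<noteq> a" using star[of a] ab by blast
    have "p = b \<or> q = b" using disj[OF ab, of p q] pq by blast
    then obtain c where c: "?n b c" "c \<noteq> a" using pq sym by blast
    obtain p' q' where pq': "?n p' q'" "p' \<noteq> b" "q' \<noteq> b" using star[of b] ab by blast
    have "p' = a \<or> q' = a" using disj[OF ab, of p' q'] pq' by blast
    moreover have "p' = c \<or> q' = c" using disj[OF c(1), of p' q'] pq' by blast
    ultimately have "?n a c" using pq' c sym by blast
    then show False using triangle[OF ab] c by blast
  qed
qed

section \<open>The bounds for global amoebas of minimum degree one\<close>

lemma global_amoeba_bounds:
  fixes G :: "'a ugraph"
  assumes G: "simple_graph G" and n: "order_of G = n" and min: "min_degree G = 1"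
    and amoeba: "global_amoeba G"
  shows "num_edges G \<le> n\<^sup>2 div 4"
    and "chromatic_number G \<le> n div 2 + 1"
    and "num_edges G = n\<^sup>2 div 4 \<Longrightarrow> clique_number G \<ge> n div 2 + 1"
    and "chromatic_number G = n div 2 + 1 \<Longrightarrow> clique_number G \<ge> n div 2 + 1"
proof -
  define k where "k = n div 2"
  define m where "m = n - k - 1"
  have finV: "finite (verts G)" and ne: "verts G \<noteq> {}" using G by (auto simp: simple_graph_def)
  have pos: "0 < degree G x" if "x \<in> verts G" for x
    using min_degree_le_degree[OF G min that] by simp
  \<comment> \<open>This gives \<open>1 \<le> k\<close>, so that the subtractions in
    \<open>m\<close> and \<open>k - 1\<close> are not truncated.\<close>
  have "2 \<le> n"
  proof -
    obtain x where "x \<in> verts G" using ne by blast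
    from pos[OF this] have "{e \<in> edges G. x \<in> e} \<noteq> {}"
      unfolding degree_def by (metis card.empty less_irrefl)
    then obtain e where "e \<in> edges G" by blast
    then have "\<exists>y z. y \<in> verts G \<and> z \<in> verts G \<and> y \<noteq> z"
      by (metis edge_doubletonE[OF G])
    then obtain y z where "{y, z} \<subseteq> verts G" "y \<noteq> z" by blast
    then show ?thesis using card_mono[OF finV, of "{y, z}"] n by simp
  qed
  then have k: "1 \<le> k" "m \<le> k" "m + k + 1 = n" "n = 2 * k \<or> n = 2 * k + 1"
    unfolding k_def m_def by linarith+
  have low: "\<exists>L\<subseteq>verts G. card L = i \<and> (\<forall>x\<in>L. degree G x \<le> i) \<and> sum (degree G) L \<le> Suc i choose 2"
    if "i \<le> n" for i
    using that n pos global_amoeba_degree_realised[OF G amoeba]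
    by (intro ex_low_degree_subset[OF G]) auto
  obtain L where L: "L \<subseteq> verts G" "card L = m" "\<forall>x\<in>L. degree G x \<le> m"
    "sum (degree G) L \<le> Suc m choose 2"
    using low[of m] k(3) by auto
  have R: "card (verts G - L) = k + 1"
    using L n k finV by (simp add: card_Diff_subset finite_subset)
  \<comment> \<open>Twice the left side is \<open>m * (m + 1) + k * (k + 1)\<close>. It equals
    \<open>2 * k * k\<close> for even \<open>n\<close>, where \<open>m = k - 1\<close>, and
    \<open>2 * k * (k + 1)\<close> for odd \<open>n\<close>, where \<open>m = k\<close>.\<close>
  have val: "(Suc m choose 2) + (k + 1 choose 2) = n\<^sup>2 div 4"
  proof -
    have two: "2 * (Suc i choose 2) = i * (i + 1)" for i :: nat
      by (induction i) (simp_all add: numeral_2_eq_2)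
    consider "n = 2 * k" "k = Suc m" | "n = 2 * k + 1" "k = m" using k by linarith
    then show ?thesis
    proof cases
      case 1
      then have "n\<^sup>2 div 4 = k * k" by (simp add: power2_eq_square)
      then show ?thesis using two[of m] two[of k] 1 by (simp add: algebra_simps)
    next
      case 2
      then have "n\<^sup>2 = 4 * (k * (k + 1)) + 1" by (simp add: power2_eq_square algebra_simps)
      then have "n\<^sup>2 div 4 = k * (k + 1)" by simp
      then show ?thesis using two[of k] 2 by (simp add: algebra_simps)
    qed
  qed
  note edge_bound = num_edges_le_degree_sum[OF G L(1), unfolded R]
  show "num_edges G \<le> n\<^sup>2 div 4" using edge_bound(1) L(4) val by linarith
  have "colorable G (k + 1)"
  \<comment> \<open>The \<open>k + 1\<close> vertices outside \<open>L\<close> get distinct colours;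
    vertices of \<open>L\<close> have degree at most \<open>m\<close>, hence at most
    \<open>k\<close>, and are coloured greedily.\<close>
  proof (rule colorable_if_merged[OF G, of "verts G - L" id])
    show "card (id ` (verts G - L)) \<le> k + 1" using R by simp
    show "degree G x < k + 1" if "x \<in> verts G - (verts G - L)" for x
      using that L(3) k by fastforce
  qed auto
  then show "chromatic_number G \<le> n div 2 + 1"
    using chromatic_number_le unfolding k_def by blast
  show "clique_number G \<ge> n div 2 + 1" if "num_edges G = n\<^sup>2 div 4"
  proof -
    have "num_edges G = sum (degree G) L + (k + 1 choose 2)"
      using that edge_bound(1) L(4) val by linarith
    then have "clique (verts G - L) (edges G)" by (rule edge_bound(2))
    then show ?thesis using card_le_clique_number[OF G, of "verts G - L"] R
      unfolding k_def by auto
  qed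
  show "clique_number G \<ge> n div 2 + 1" if "chromatic_number G = n div 2 + 1"
  proof -
    \<comment> \<open>The size \<open>k - 1\<close> keeps the degrees in \<open>M\<close> below
      \<open>k\<close>, as greedy colouring with \<open>k\<close> colours requires, and leaves
      \<open>k + 1\<close> vertices for even \<open>n\<close> and \<open>k + 2\<close> for odd
      \<open>n\<close>.\<close>
    have "k - 1 \<le> n" using k(3) by linarith
    from low[OF this] obtain M
      where M: "M \<subseteq> verts G" "card M = k - 1" "\<forall>x\<in>M. degree G x \<le> k - 1"
      by blast
    have "card (verts G - M) = n - (k - 1)"
      using M n finV by (simp add: card_Diff_subset finite_subset)
    then have "card (verts G - M) = k + 1 \<or> card (verts G - M) = k + 2" using k by linarith
    moreover have "\<not> colorable G k" using chromatic_number_le that unfolding k_def by fastforce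
    moreover have "degree G x < k" if "x \<in> verts G - (verts G - M)" for x
      using that M(3) k by fastforce
    ultimately obtain K where "K \<subseteq> verts G - M" "clique K (edges G)" "card K = k + 1"
      using clique_if_not_colorable[OF G, of "verts G - M" k] by blast
    then show ?thesis using card_le_clique_number[OF G, of K] unfolding k_def by auto
  qed
qed


section \<open>Extremal amoebas\<close>

text \<open>A transposition is an involution, so membership in the image of the edge set can be
  tested by applying it once more. Testing distinct \<open>a\<close> and \<open>b\<close> suffices,
  as all sets involved have two elements.\<close>

lemma exchangeableI:
  assumes G: "simple_graph G" and xy: "x \<in> verts G" "y \<in> verts G"
    and e: "e \<in> edges G" "e' \<in> complement_edges G \<union> {e}"
    and eq: "\<And>a b. a \<noteq> b \<Longrightarrow>
      {Transposition.transpose x y a, Transposition.transpose x y b} \<in> edges G \<longleftrightarrow>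
      {a, b} \<in> edges G - {e} \<union> {e'}"
  shows "exchangeable G x y"
proof -
  let ?\<tau> = "Transposition.transpose x y"
  have sub: "edges G - {e} \<union> {e'} \<subseteq> [verts G]\<^bsup>2\<^esup>"
    using G e unfolding simple_graph_def complement_edges_def by auto
  have iff: "?\<tau> ` f \<in> edges G \<longleftrightarrow> f \<in> edges G - {e} \<union> {e'}" if "card f = 2" for f
    using that eq by (auto simp: card_2_iff)
  have card2: "card f = 2" if "f \<in> edges G" for f
    using that edge_doubletonE[OF G that] by (metis card_2_iff)
  have "(`) ?\<tau> ` edges G = edges G - {e} \<union> {e'}"
  proof (intro equalityI subsetI)
    fix f assume "f \<in> (`) ?\<tau> ` edges G"
    then obtain g where g: "g \<in> edges G" "f = ?\<tau> ` g" by blast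
    then have "card f = 2" using card2[OF g(1)] by (simp add: card_image)
    moreover have "?\<tau> ` f \<in> edges G" using g by (simp add: image_image)
    ultimately show "f \<in> edges G - {e} \<union> {e'}" using iff by blast
  next
    fix f assume f: "f \<in> edges G - {e} \<union> {e'}"
    then have "card f = 2" using sub by (auto simp: nsets_def)
    then have "?\<tau> ` f \<in> edges G" using iff f by blast
    then have "?\<tau> ` ?\<tau> ` f \<in> (`) ?\<tau> ` edges G" by (rule imageI)
    then show "f \<in> (`) ?\<tau> ` edges G" by (simp add: image_image)
  qed
  then show ?thesis unfolding exchangeable_def using xy e by blast
qed

lemma exchangeable_commute: "exchangeable G x y \<longleftrightarrow> exchangeable G y x"
  unfolding exchangeable_def by (auto simp: transpose_commute)

text \<open>The transposition is an automorphism, realised by replacing an arbitrary edge by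
  itself.\<close>

lemma exchangeable_if_twins:
  assumes G: "simple_graph G" and xy: "x \<in> verts G" "y \<in> verts G" "x \<noteq> y"
    and "edges G \<noteq> {}"
    and nb: "\<And>z. z \<noteq> x \<Longrightarrow> z \<noteq> y \<Longrightarrow> {x, z} \<in> edges G \<longleftrightarrow> {y, z} \<in> edges G"
  shows "exchangeable G x y"
proof -
  obtain e where e: "e \<in> edges G" using assms(5) by blast
  show ?thesis
  proof (rule exchangeableI[OF G xy(1,2) e])
    fix a b :: 'a assume "a \<noteq> b"
    then show "{Transposition.transpose x y a, Transposition.transpose x y b} \<in> edges G \<longleftrightarrow>
        {a, b} \<in> edges G - {e} \<union> {e}"
      using nb[of a] nb[of b] xy(3) e
      by (cases "a = x"; cases "a = y"; cases "b = x"; cases "b = y")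
        (simp_all add: insert_commute insert_absorb)
  qed simp
qed

text \<open>Apart from \<open>x\<close> and \<open>y\<close> themselves, the two neighbourhoods
  differ only in \<open>w\<close>, so the swap merely moves the edge from \<open>{x, w}\<close> to
  \<open>{y, w}\<close>.\<close>

lemma exchangeable_if_differ_at:
  assumes G: "simple_graph G" and y: "y \<in> verts G"
    and w: "{x, w} \<in> edges G" "{y, w} \<notin> edges G" "y \<noteq> w"
    and nb: "\<And>z. z \<noteq> x \<Longrightarrow> z \<noteq> y \<Longrightarrow> z \<noteq> w \<Longrightarrow> {x, z} \<in> edges G \<longleftrightarrow> {y, z} \<in> edges G"
  shows "exchangeable G x y"
proof (rule exchangeableI[OF G _ y w(1)])
  have xw: "x \<in> verts G" "w \<in> verts G" "x \<noteq> w" using simple_graph_edgeD[OF G w(1)] by auto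
  have "x \<noteq> y" using w by blast
  show "x \<in> verts G" by fact
  show "{y, w} \<in> complement_edges G \<union> {{x, w}}"
    using xw y w unfolding complement_edges_def by simp
  fix a b :: 'a assume "a \<noteq> b"
  then show "{Transposition.transpose x y a, Transposition.transpose x y b} \<in> edges G \<longleftrightarrow>
      {a, b} \<in> edges G - {{x, w}} \<union> {{y, w}}"
    using nb[of a] nb[of b] \<open>x \<noteq> y\<close> xw(3) w
    by (cases "a = x"; cases "a = y"; cases "b = x"; cases "b = y"; cases "a = w"; cases "b = w")
      (simp_all add: insert_commute doubleton_eq_iff)
qed

lemma exchangeable_add_isolated:
  fixes G :: "'a ugraph"
  assumes "exchangeable G x y"
  shows "exchangeable (add_isolated G t) (Inl x) (Inl y)"
proof -
  let ?I = "(`) (Inl :: 'a \<Rightarrow> 'a + nat)" and ?\<tau> = "Transposition.transpose x y"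
  obtain e e' where e: "e \<in> edges G" "e' \<in> complement_edges G \<union> {e}"
    and eq: "(`) ?\<tau> ` edges G = edges G - {e} \<union> {e'}"
    using assms unfolding exchangeable_def by (elim conjE bexE) (rule that)
  have inj: "?I a = ?I b \<longleftrightarrow> a = b" for a b by (simp add: inj_image_eq_iff)
  have \<tau>: "Transposition.transpose (Inl x) (Inl y) (Inl a :: 'a + nat) = Inl (?\<tau> a)" for a
    by (simp add: Transposition.transpose_def)
  have "(`) (Transposition.transpose (Inl x) (Inl y)) ` ?I ` edges G = ?I ` (`) ?\<tau> ` edges G"
    by (simp add: image_image \<tau>)
  also have "\<dots> = ?I ` edges G - {?I e} \<union> {?I e'}"
    unfolding eq using inj by auto
  finally have "(`) (Transposition.transpose (Inl x) (Inl y)) ` edges (add_isolated G t) =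
      edges (add_isolated G t) - {?I e} \<union> {?I e'}"
    by (simp add: add_isolated_def)
  moreover have "?I e' \<in> complement_edges (add_isolated G t) \<union> {?I e}"
  proof (cases "e' = e")
    case False
    then have "e' \<in> [verts G]\<^bsup>2\<^esup>" "e' \<notin> edges G" using e by (auto simp: complement_edges_def)
    moreover then have "?I e' \<in> [verts G <+> {..<t}]\<^bsup>2\<^esup>"
      by (auto simp: nsets_def card_image)
    ultimately show ?thesis
      using inj unfolding complement_edges_def add_isolated_def by auto
  qed simp
  moreover have "?I e \<in> edges (add_isolated G t)" using e by (simp add: add_isolated_def)
  moreover have "Inl x \<in> verts (add_isolated G t)" "Inl y \<in> verts (add_isolated G t)"
    using assms by (auto simp: exchangeable_def add_isolated_def)
  ultimately show ?thesis unfolding exchangeable_def by blast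
qed

text \<open>The leaf \<open>l\<close> can be exchanged with any isolated vertex by moving its only
  edge, so the exchange relation reaches the added vertices as well.\<close>

lemma global_amoeba_if_exchangeable_connected:
  fixes G :: "'a ugraph"
  assumes G: "simple_graph G"
    and leaf: "{l, w} \<in> edges G" "\<And>z. {l, z} \<in> edges G \<Longrightarrow> z = w"
    and conn: "\<And>x. x \<in> verts G \<Longrightarrow> (exchangeable G)\<^sup>*\<^sup>* l x"
  shows "global_amoeba G"
  unfolding global_amoeba_def
\<comment> \<open>No minimal number of isolated vertices is required: the threshold is 0.\<close>
proof (intro exI[of _ 0] allI impI)
  fix t
  let ?H = "add_isolated G t"
  have H: "simple_graph ?H" using G by (rule simple_graph_add_isolated)
  have l: "Inl l \<in> verts ?H"
    using simple_graph_edgeD[OF G leaf(1)] by (auto simp: add_isolated_def)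
  have noInr: "{Inr i, z} \<notin> edges ?H" "{z, Inr i} \<notin> edges ?H" for i z
    unfolding add_isolated_def by (auto simp: set_eq_iff)
  show "local_amoeba ?H"
  proof (rule local_amoeba_if_exchangeable_connected[OF H l])
    fix x assume x: "x \<in> verts ?H"
    show "(exchangeable ?H)\<^sup>*\<^sup>* (Inl l) x"
    proof (cases x)
      case (Inl y)
      have "(exchangeable ?H)\<^sup>*\<^sup>* (Inl l) (Inl y)" if "(exchangeable G)\<^sup>*\<^sup>* l y" for y
        using that
      proof (induction rule: rtranclp_induct)
        case (step y z)
        show ?case
          using step.IH exchangeable_add_isolated[OF step.hyps(2)]
          by (rule rtranclp.rtrancl_into_rtrancl)
      qed simp
      moreover have "y \<in> verts G" using x Inl by (auto simp: add_isolated_def)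
      ultimately show ?thesis using conn Inl by metis
    next
      case (Inr i)
      have "exchangeable ?H (Inl l) x"
      proof (rule exchangeable_if_differ_at[OF H x])
        show "{Inl l, Inl w} \<in> edges ?H" using leaf(1) by simp
        show "{x, Inl w} \<notin> edges ?H" unfolding Inr by (rule noInr)
        show "x \<noteq> Inl w" by (simp add: Inr)
        show "{Inl l, z} \<in> edges ?H \<longleftrightarrow> {x, z} \<in> edges ?H" if "z \<noteq> Inl w" for z
        proof (cases z)
          case (Inl u)
          then have "{Inl l, z} \<notin> edges ?H" using that leaf(2)[of u] by auto
          then show ?thesis using noInr(1) Inr by simp
        next
          case (Inr j)
          then show ?thesis using noInr \<open>x = Inr i\<close> by simp
        qed
      qed
      then show ?thesis by blast
    qed
  qed
qed

lemma min_degree_eq_1_if_leaf: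
  assumes G: "simple_graph G"
    and leaf: "{l, w} \<in> edges G" "\<And>z. {l, z} \<in> edges G \<Longrightarrow> z = w"
    and nb: "\<And>x. x \<in> verts G \<Longrightarrow> \<exists>y. {x, y} \<in> edges G"
  shows "min_degree G = 1"
  unfolding min_degree_def
proof (rule Min_eqI)
  have fin: "finite (verts G)" using G by (simp add: simple_graph_def)
  then show "finite (degree G ` verts G)" by simp
  have "{e \<in> edges G. l \<in> e} = {{l, w}}"
  proof (intro equalityI subsetI)
    fix e assume "e \<in> {e \<in> edges G. l \<in> e}"
    then have "e \<in> edges G" "l \<in> e" by auto
    then obtain z where "e = {l, z}"
      using edge_doubletonE[OF G] by (metis insertE insert_commute singletonD)
    then show "e \<in> {{l, w}}" using leaf(2)[of z] \<open>e \<in> edges G\<close> by simp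
  qed (use leaf(1) in auto)
  then have "degree G l = 1" by (simp add: degree_def)
  then show "1 \<in> degree G ` verts G"
    using simple_graph_edgeD(1)[OF G leaf(1)] by (metis imageI)
  fix d assume "d \<in> degree G ` verts G"
  then obtain x where x: "x \<in> verts G" "d = degree G x" by blast
  then obtain y where "{x, y} \<in> edges G" using nb by blast
  then have "{x, y} \<in> {e \<in> edges G. x \<in> e}" by simp
  then show "1 \<le> d"
    unfolding x degree_def using finite_edges[OF G]
    by (metis (no_types, lifting) One_nat_def Suc_leI card_gt_0_iff empty_iff finite_subset mem_Collect_eq subsetI)
qed

section \<open>Half graphs\<close>

text \<open>The connected graph of order \<open>n\<close> in which only two vertices share a degree.\<close>

definition half_graph :: "nat \<Rightarrow> nat ugraph" where
  "half_graph n = ({1..n}, {{i, j} |i j. i < j \<and> j \<le> n \<and> n < i + j})"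

lemma half_graph_edge_iff:
  "{i, j} \<in> edges (half_graph n) \<longleftrightarrow> i \<noteq> j \<and> i \<le> n \<and> j \<le> n \<and> n < i + j"
  unfolding half_graph_def by (auto simp: doubleton_eq_iff) (metis add.commute linorder_neqE_nat)

lemma simple_half_graph:
  assumes "2 \<le> n"
  shows "simple_graph (half_graph n)"
  using assms unfolding simple_graph_def half_graph_def by auto

text \<open>Edges are counted by their larger end \<open>j\<close>; the smaller end runs from
  \<open>n + 1 - j\<close> to \<open>j - 1\<close>. The sum is evaluated by induction in steps of
  two, since \<open>n\<^sup>2 div 4\<close> grows by \<open>n + 1\<close> from \<open>n\<close> to
  \<open>n + 2\<close>.\<close>

lemma num_edges_half_graph: "num_edges (half_graph n) = n\<^sup>2 div 4"
proof -
  let ?S = "SIGMA j:{1..n}. {Suc n - j..<j}"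
  have "edges (half_graph n) = (\<lambda>(j, i). {i, j}) ` ?S"
    unfolding half_graph_def by (force simp: image_iff)
  moreover have "inj_on (\<lambda>(j, i). {i, j}) ?S"
    by (auto simp: inj_on_def doubleton_eq_iff)
  ultimately have "num_edges (half_graph n) = card ?S" by (simp add: card_image)
  also have "\<dots> = (\<Sum>j=1..n. j - (Suc n - j))" by simp
  also have "\<dots> = n\<^sup>2 div 4"
  proof (induction n rule: induct_nat_012)
    case (ge2 n)
    have "(\<Sum>j=1..Suc (Suc n). j - (Suc (Suc (Suc n)) - j)) =
        (\<Sum>j=0..Suc n. Suc j - (Suc (Suc (Suc n)) - Suc j))"
      using sum.shift_bounds_cl_Suc_ivl[of "\<lambda>j. j - (Suc (Suc (Suc n)) - j)" 0 "Suc n"] by simp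
    also have "\<dots> = (\<Sum>j=0..n. Suc j - (Suc (Suc n) - j)) + Suc n" by simp
    \<comment> \<open>The term at \<open>j = 0\<close> vanishes by truncated subtraction.\<close>
    also have "(\<Sum>j=0..n. Suc j - (Suc (Suc n) - j)) = (\<Sum>j=1..n. Suc j - (Suc (Suc n) - j))"
      by (rule sum.mono_neutral_right) auto
    also have "\<dots> = (\<Sum>j=1..n. j - (Suc n - j))"
      by (rule sum.cong) auto
    also have "\<dots> = n\<^sup>2 div 4" by (rule ge2)
    also have "n\<^sup>2 div 4 + Suc n = (Suc (Suc n))\<^sup>2 div 4"
    proof -
      have "(Suc (Suc n))\<^sup>2 = n\<^sup>2 + Suc n * 4" by (simp add: power2_eq_square)
      then show ?thesis by (simp only: div_mult_self1)
    qed
    finally show ?case .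
  qed simp_all
  finally show ?thesis .
qed

text \<open>Vertex 1 is a leaf at \<open>n\<close>. The neighbours of \<open>i\<close> are the
  vertices above \<open>n - i\<close> other than \<open>i\<close>, so apart from themselves
  \<open>i\<close> and \<open>Suc i\<close> can differ only at \<open>n - i\<close>; they are twins
  if \<open>n - i\<close> is one of the two.\<close>

lemma half_graph_amoeba:
  assumes n: "2 \<le> n"
  shows "min_degree (half_graph n) = 1" "global_amoeba (half_graph n)"
proof -
  let ?G = "half_graph n"
  note G = simple_half_graph[OF n]
  have V: "verts ?G = {1..n}" by (simp add: half_graph_def)
  have leaf: "{1, n} \<in> edges ?G" "\<And>z. {1, z} \<in> edges ?G \<Longrightarrow> z = n"
    using n by (auto simp: half_graph_edge_iff)
  have "\<exists>y. {x, y} \<in> edges ?G" if "x \<in> verts ?G" for x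
    using that n by (cases "x = n") (auto simp: half_graph_edge_iff V intro: exI[of _ 1] exI[of _ n])
  then show "min_degree ?G = 1" using min_degree_eq_1_if_leaf[OF G leaf] by blast
  have step: "exchangeable ?G i (Suc i)" if i: "1 \<le> i" "i < n" for i
  proof (cases "n - i = i \<or> n - i = Suc i")
    case True
    have "edges ?G \<noteq> {}" using leaf(1) by blast
    then show ?thesis
      using i True by (intro exchangeable_if_twins[OF G]) (auto simp: V half_graph_edge_iff)
  next
    case False
    \<comment> \<open>The extra neighbour \<open>n - i\<close> belongs to \<open>Suc i\<close>,
      which therefore comes first.\<close>
    have "exchangeable ?G (Suc i) i"
      using i False
      by (intro exchangeable_if_differ_at[OF G, of _ _ "n - i"]) (auto simp: V half_graph_edge_iff)
    then show ?thesis by (simp add: exchangeable_commute)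
  qed
  have "(exchangeable ?G)\<^sup>*\<^sup>* 1 i" if "1 \<le> i" "i \<le> n" for i
    using that
  proof (induction i rule: dec_induct)
    case (step i)
    then show ?case using \<open>\<And>i. 1 \<le> i \<Longrightarrow> i < n \<Longrightarrow> exchangeable ?G i (Suc i)\<close>[of i] by auto
  qed simp
  then show "global_amoeba ?G"
    using global_amoeba_if_exchangeable_connected[OF G leaf] V by auto
qed

text \<open>The triangle \<open>0\<close>, \<open>1\<close>, \<open>2\<close> with pendant vertices
  \<open>3\<close> at \<open>0\<close> and \<open>4\<close> at \<open>1\<close>.\<close>

definition bull :: "nat ugraph" where
  "bull = ({..<5}, {{0, 1}, {0, 2}, {1, 2}, {0, 3}, {1, 4}})"

lemma simple_bull: "simple_graph bull"
  unfolding simple_graph_def bull_def by (auto simp: lessThan_empty_iff)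

lemma bull_amoeba: "min_degree bull = 1" "global_amoeba bull"
proof -
  have edge: "{x, y} \<in> edges bull \<longleftrightarrow>
      {x, y} = {0, 1} \<or> {x, y} = {0, 2} \<or> {x, y} = {1, 2} \<or> {x, y} = {0, 3} \<or> {x, y} = {1, 4}"
    for x y by (auto simp: bull_def)
  note edge = edge[unfolded doubleton_eq_iff]
  have V: "x \<in> verts bull \<longleftrightarrow> x = 0 \<or> x = 1 \<or> x = 2 \<or> x = 3 \<or> x = 4" for x
    unfolding bull_def by auto
  have leaf: "{3, 0} \<in> edges bull" "\<And>z. {3, z} \<in> edges bull \<Longrightarrow> z = 0"
    by (auto simp: edge)
  have "\<exists>y. {x, y} \<in> edges bull" if "x \<in> verts bull" for x
    using that unfolding V edge by auto
  then show "min_degree bull = 1" using min_degree_eq_1_if_leaf[OF simple_bull leaf] by blast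
  note differ = exchangeable_if_differ_at[OF simple_bull]
  \<comment> \<open>Vertex 2 is exchangeable with every other vertex; each swap moves one edge,
    whose fixed end is given below as the witness.\<close>
  have ex: "exchangeable bull 2 3" "exchangeable bull 0 2" "exchangeable bull 1 2"
    "exchangeable bull 2 4"
    subgoal by (rule differ[of _ _ 1]) (auto simp: V edge)
    subgoal by (rule differ[of _ _ 3]) (auto simp: V edge)
    subgoal by (rule differ[of _ _ 4]) (auto simp: V edge)
    subgoal by (rule differ[of _ _ 0]) (auto simp: V edge)
    done
  have "(exchangeable bull)\<^sup>*\<^sup>* 3 2"
    using ex(1) exchangeable_commute[of bull 2 3] by blast
  have "(exchangeable bull)\<^sup>*\<^sup>* 3 x" if "x \<in> verts bull" for x
  proof -
    have "x = 2 \<or> exchangeable bull 2 x"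
      using that ex exchangeable_commute[of bull 2] unfolding V by blast
    then show ?thesis using \<open>(exchangeable bull)\<^sup>*\<^sup>* 3 2\<close> by auto
  qed
  then show "global_amoeba bull"
    using global_amoeba_if_exchangeable_connected[OF simple_bull leaf] by blast
qed

section \<open>Bounds, sharpness and failure of the converse\<close>

theorem theorem5p2:
  shows
    "(\<forall>(G :: 'a ugraph) n.
        simple_graph G \<and> order_of G = n \<and> min_degree G = 1 \<and> global_amoeba G \<longrightarrow>
          num_edges G \<le> n\<^sup>2 div 4 \<and>
          clique_number G \<le> chromatic_number G \<and> chromatic_number G \<le> n div 2 + 1 \<and>
          (num_edges G = n\<^sup>2 div 4 \<longrightarrow>
             clique_number G = chromatic_number G \<and> chromatic_number G = n div 2 + 1) \<and>
          (clique_number G = n div 2 + 1 \<longleftrightarrow> chromatic_number G = n div 2 + 1)) \<and>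
     (\<forall>n\<ge>2. \<exists>G :: nat ugraph.
        simple_graph G \<and> order_of G = n \<and> min_degree G = 1 \<and> global_amoeba G \<and>
        num_edges G = n\<^sup>2 div 4) \<and>
     (\<forall>n\<ge>2. \<exists>G :: nat ugraph.
        simple_graph G \<and> order_of G = n \<and> min_degree G = 1 \<and> global_amoeba G \<and>
        clique_number G = chromatic_number G \<and> chromatic_number G = n div 2 + 1) \<and>
     (\<exists>(G :: nat ugraph) n.
        simple_graph G \<and> order_of G = n \<and> min_degree G = 1 \<and> global_amoeba G \<and>
        clique_number G = chromatic_number G \<and> chromatic_number G = n div 2 + 1 \<and>
        num_edges G < n\<^sup>2 div 4)"
proof (intro conjI)
  show "\<forall>(G :: 'a ugraph) n.
        simple_graph G \<and> order_of G = n \<and> min_degree G = 1 \<and> global_amoeba G \<longrightarrow>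
          num_edges G \<le> n\<^sup>2 div 4 \<and>
          clique_number G \<le> chromatic_number G \<and> chromatic_number G \<le> n div 2 + 1 \<and>
          (num_edges G = n\<^sup>2 div 4 \<longrightarrow>
             clique_number G = chromatic_number G \<and> chromatic_number G = n div 2 + 1) \<and>
          (clique_number G = n div 2 + 1 \<longleftrightarrow> chromatic_number G = n div 2 + 1)"
  proof (intro allI impI, elim conjE)
    fix G :: "'a ugraph" and n
    assume G: "simple_graph G" "order_of G = n" "min_degree G = 1" "global_amoeba G"
    note b = global_amoeba_bounds[OF G] and cl = clique_number_le_chromatic_number[OF G(1)]
    show "num_edges G \<le> n\<^sup>2 div 4 \<and>
          clique_number G \<le> chromatic_number G \<and> chromatic_number G \<le> n div 2 + 1 \<and>
          (num_edges G = n\<^sup>2 div 4 \<longrightarrow>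
             clique_number G = chromatic_number G \<and> chromatic_number G = n div 2 + 1) \<and>
          (clique_number G = n div 2 + 1 \<longleftrightarrow> chromatic_number G = n div 2 + 1)"
      using b cl by linarith
  qed
  have half: "simple_graph (half_graph n) \<and> order_of (half_graph n) = n \<and>
      min_degree (half_graph n) = 1 \<and> global_amoeba (half_graph n) \<and>
      num_edges (half_graph n) = n\<^sup>2 div 4" if "2 \<le> n" for n
    using simple_half_graph[OF that] half_graph_amoeba[OF that] num_edges_half_graph[of n]
    by (simp add: half_graph_def)
  then show "\<forall>n\<ge>2. \<exists>G :: nat ugraph.
        simple_graph G \<and> order_of G = n \<and> min_degree G = 1 \<and> global_amoeba G \<and>
        num_edges G = n\<^sup>2 div 4"
    by blast
  show "\<forall>n\<ge>2. \<exists>G :: nat ugraph.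
        simple_graph G \<and> order_of G = n \<and> min_degree G = 1 \<and> global_amoeba G \<and>
        clique_number G = chromatic_number G \<and> chromatic_number G = n div 2 + 1"
  proof (intro allI impI)
    fix n :: nat assume "2 \<le> n"
    note h = half[OF this]
    \<comment> \<open>The extremal number of edges already forces the extremal clique.\<close>
    then have "n div 2 + 1 \<le> clique_number (half_graph n)"
      "chromatic_number (half_graph n) \<le> n div 2 + 1"
      using global_amoeba_bounds(2,3)[of "half_graph n" n] by blast+
    moreover have "clique_number (half_graph n) \<le> chromatic_number (half_graph n)"
      using clique_number_le_chromatic_number h by blast
    ultimately show "\<exists>G :: nat ugraph.
        simple_graph G \<and> order_of G = n \<and> min_degree G = 1 \<and> global_amoeba G \<and>
        clique_number G = chromatic_number G \<and> chromatic_number G = n div 2 + 1"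
      using h by (intro exI[of _ "half_graph n"]) linarith
  qed
  \<comment> \<open>For order 5 the extremal values are 3 and 6: the bull has a triangle but at most
    five edges.\<close>
  have order: "order_of bull = 5" by (simp add: bull_def)
  have "clique {0, 1, 2} (edges bull)" by (auto simp: clique_def bull_def)
  moreover have "{0, 1, 2} \<subseteq> verts bull" by (simp add: bull_def)
  ultimately have "3 \<le> clique_number bull"
    using card_le_clique_number[OF simple_bull, of "{0, 1, 2}"] by simp
  moreover have "chromatic_number bull \<le> 3"
    using global_amoeba_bounds(2)[OF simple_bull order bull_amoeba] by simp
  moreover have "num_edges bull \<le> 5"
    unfolding bull_def snd_conv by (simp add: card_insert_if)
  ultimately show "\<exists>(G :: nat ugraph) n.
        simple_graph G \<and> order_of G = n \<and> min_degree G = 1 \<and> global_amoeba G \<and>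
        clique_number G = chromatic_number G \<and> chromatic_number G = n div 2 + 1 \<and>
        num_edges G < n\<^sup>2 div 4"
    using clique_number_le_chromatic_number[OF simple_bull] simple_bull bull_amoeba order
    by (intro exI[of _ bull] exI[of _ 5]) simp
qed

end
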